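(* Let $(x,t_0)\in\mathcal D\times\mathcal T$ and let $x(t)$ be the solution of the Driver-type ODE $\dot x_i=\sum_{j=1}^n v_{i,j}(t)x_ix_j$, $i=1,\dots,n$, with $x(t_0)=x$. The coefficients $c_k(i)=x_i^{(k)}(t_0)$ of the Taylor expansion $x_i(t)=\sum_{k=0}^\infty c_k(i)\frac{(t-t_0)^k}{k!}$ are given by $c_0(i)=x_i$ and, for all $k\ge1$, $$c_k(i)=\sum_{s=2}^{k+1}\ \sum_{i_1,\dots,i_{s-1}\in\mathcal I}v^{k+1,s}_{i,i_1,\dots,i_{s-1}}(t_0)\;x_ix_{i_1}\cdots x_{i_{s-1}},\qquad \mathcal I=\{1,\dots,n\},$$ where, setting $i_0=i$, the coefficients $v^{k+1,s}_{i,i_1,\dots,i_{s-1}}=v^{k+1,s}_{i,i_1,\dots,i_{s-1}}(t)$, $t\in\mathbf I_{x,t_0}$, are given by the recursive equations ($k\ge2$) $$v^{k+1,k+1}_{i,i_1,\dots,i_k}=v^{k,k}_{i,i_1,\dots,i_{k-1}}\Big(\sum_{j=0}^{k-1}v_{i_j,i_k}\Big),$$ $$v^{k+1,s}_{i,i_1,\dots,i_{s-1}}=v^{k,s-1}_{i,i_1,\dots,i_{s-2}}\Big(\sum_{j=0}^{s-2}v_{i_j,i_{s-1}}\Big)+\partial_tv^{k,s}_{i,i_1,\dots,i_{s-1}},\qquad s=3,\dots,k,$$ $$v^{k+1,2}_{i,i_1}=\partial_tv^{k,2}_{i,i_1}\quad\big(=\partial_t^{k-1}v_{i,i_1}\big),$$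 initialized by $v^{2,2}_{i,i_1}=v_{i,i_1}$.
   Context: The $v_{i,j}$, $i,j=1,\dots,n$, are real analytic functions on an open interval $\mathcal T\subset\mathbb R$. $\mathcal D=\{x\in\mathbb R^n: x_i\ne0\ \text{for all } i\}$. $\mathbf I_{x,t_0}\subset\mathcal T$ is the maximal open interval of definition of the solution with $x(t_0)=x$; the solution is analytic there. The Taylor expansion holds on an open interval centered at $t_0$ and contained in $\mathbf I_{x,t_0}$ where the series converge. $\partial_t$ is the time derivative, and $x_i^{(k)}$ is the $k$-th time derivative of $x_i(\cdot)$. *)

theory Defs
  imports "HOL-Analysis.Analysis"
begin

definition real_analytic_on :: "(real \<Rightarrow> real) \<Rightarrow> real set \<Rightarrow> bool" where
  "real_analytic_on f S \<longleftrightarrow>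
     (\<forall>t\<in>S. \<exists>r>0. \<exists>a. \<forall>u. \<bar>u - t\<bar> < r \<longrightarrow> (\<lambda>k. a k * (u - t) ^ k) sums f u)"

definition open_interval :: "real set \<Rightarrow> bool" where
  "open_interval I \<longleftrightarrow> open I \<and> is_interval I \<and> I \<noteq> {}"

definition nonzero_coords :: "(real ^ 'n) set" where
  "nonzero_coords = {x. \<forall>i. x $ i \<noteq> 0}"

(* The values of X outside the interval I are irrelevant. *)
definition driver_solution ::
  "('n::finite \<Rightarrow> 'n \<Rightarrow> real \<Rightarrow> real) \<Rightarrow> real set \<Rightarrow> real \<Rightarrow> real ^ 'n \<Rightarrow> real set \<Rightarrow> (real \<Rightarrow> real ^ 'n) \<Rightarrow> bool"
  where
  "driver_solution v T t0 x I X \<longleftrightarrow>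
     open_interval I \<and> I \<subseteq> T \<and> t0 \<in> I \<and> X t0 = x \<and>
     (\<forall>t\<in>I. \<forall>i. ((\<lambda>u. X u $ i) has_real_derivative (\<Sum>j\<in>UNIV. v i j t * X t $ i * X t $ j)) (at t))"

definition maximal_driver_solution ::
  "('n::finite \<Rightarrow> 'n \<Rightarrow> real \<Rightarrow> real) \<Rightarrow> real set \<Rightarrow> real \<Rightarrow> real ^ 'n \<Rightarrow> real set \<Rightarrow> (real \<Rightarrow> real ^ 'n) \<Rightarrow> bool"
  where
  "maximal_driver_solution v T t0 x I X \<longleftrightarrow>
     driver_solution v T t0 x I X \<and>
     (\<forall>J Y. driver_solution v T t0 x J Y \<and> I \<subseteq> J \<and> (\<forall>t\<in>I. Y t = X t) \<longrightarrow> J = I)"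

definition taylor_coeff :: "(real \<Rightarrow> real ^ 'n) \<Rightarrow> real \<Rightarrow> nat \<Rightarrow> 'n \<Rightarrow> real" where
  "taylor_coeff X t0 k i = (deriv ^^ k) (\<lambda>t. X t $ i) t0"

(* driver_coeff v m s [i_0, ..., i_(s-1)] is the coefficient function v^{m,s}_{i_0,...,i_(s-1)};
   it is meaningful for 2 \<le> s \<le> m and index lists of length s, and 0 is used for other m, s. *)
primrec driver_coeff ::
  "('n \<Rightarrow> 'n \<Rightarrow> real \<Rightarrow> real) \<Rightarrow> nat \<Rightarrow> nat \<Rightarrow> 'n list \<Rightarrow> real \<Rightarrow> real" where
  "driver_coeff v 0 s js = (\<lambda>t. 0)"
| "driver_coeff v (Suc k) s js =
     (if k = 1 \<and> s = 2 then v (js ! 0) (js ! 1)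
      else if k \<ge> 2 \<and> s = k + 1 then
        (\<lambda>t. driver_coeff v k k (butlast js) t * (\<Sum>j=0..k-1. v (js ! j) (js ! k) t))
      else if k \<ge> 2 \<and> 3 \<le> s \<and> s \<le> k then
        (\<lambda>t. driver_coeff v k (s - 1) (butlast js) t * (\<Sum>j=0..s-2. v (js ! j) (js ! (s - 1)) t)
             + deriv (driver_coeff v k s js) t)
      else if k \<ge> 2 \<and> s = 2 then deriv (driver_coeff v k 2 js)
      else (\<lambda>t. 0))"

end

theory Submission
  imports Defs
begin

text \<open>
  There are two separate things to show: an identity between derivatives, which holds on the
  whole interval of definition, and the convergence of the Taylor series near \<^term>\<open>t0\<close>.

  The identity is obtained by differentiating along the flow. A derivative of the solution is a
  linear combination, with time-dependent coefficients, of monomials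
  \<open>X\<^sub>i X\<^sub>j\<^sub>1 \<cdots> X\<^sub>j\<^sub>r\<close>. Differentiating a coefficient keeps the monomial. Differentiating the
  monomial multiplies it, for each new index \<open>l\<close>, by \<open>X\<^sub>l\<close> and by the sum of
  \<open>v\<^sub>j\<^sub>l\<close> over the indices \<open>j\<close> already present, because the derivative of
  a factor \<open>X\<^sub>j\<close> is \<open>X\<^sub>j\<close> times \<open>\<Sum>\<^sub>l v\<^sub>j\<^sub>l X\<^sub>l\<close>. Collecting the terms that belong to one index list gives exactly the
  recursion for the coefficients (\<open>driver_expansion_has_derivative\<close>). By induction this also
  shows that the solution is smooth, since the coefficients are.

  For the convergence, write \<open>a\<^sub>k = X\<^sup>(\<^sup>k\<^sup>) / k!\<close>. The equation becomes a recurrence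
  that expresses \<open>(k + 1) a\<^sub>k\<^sub>+\<^sub>1\<close> by Cauchy products of the corresponding quantities for
  \<open>v\<close>, \<open>X\<close> and \<open>X\<close>. If \<open>\<bar>a\<^sub>m\<bar> \<le> B C\<^sup>m\<close> for \<open>m \<le> k\<close>, a Cauchy product of two such sequences has at
  most \<open>k + 1\<close> terms, all with the same bound, and the factor \<open>k + 1\<close> on the left absorbs their
  number. So the recurrence propagates a bound
  \<open>\<bar>a\<^sub>k\<bar> \<le> B C\<^sup>k\<close> (\<open>quadratic_recurrence_bound\<close>). The constants come from the sup norm of the
  solution and from a geometric bound for \<open>v\<close>, both uniform on a neighbourhood of \<^term>\<open>t0\<close>
  (\<open>driver_solution_local_bound\<close>). Hence the Lagrange remainder tends to zero
  (\<open>taylor_tower_sums\<close>).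
\<close>

section \<open>Smooth functions and their normalised derivatives\<close>

text \<open>
  A tower consists of the functions \<open>F\<^sub>k = f\<^sup>(\<^sup>k\<^sup>) / k!\<close> for some smooth \<open>f\<close>. With this
  normalisation Leibniz's rule is the Cauchy product, without binomial coefficients, and
  analyticity is a geometric bound on the tower.
\<close>

definition taylor_tower :: "real set \<Rightarrow> (nat \<Rightarrow> real \<Rightarrow> real) \<Rightarrow> bool" where
  "taylor_tower S F \<longleftrightarrow>
     (\<forall>k. \<forall>t\<in>S. (F k has_real_derivative real (Suc k) * F (Suc k) t) (at t))"

definition smooth_on_reals :: "real set \<Rightarrow> (real \<Rightarrow> real) \<Rightarrow> bool" where
  "smooth_on_reals S f \<longleftrightarrow> (\<forall>k. \<forall>t\<in>S. (deriv ^^ k) f differentiable at t)"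

lemma taylor_towerD:
  "taylor_tower S F \<Longrightarrow> t \<in> S \<Longrightarrow> (F k has_real_derivative real (Suc k) * F (Suc k) t) (at t)"
  by (simp add: taylor_tower_def)

lemma taylor_tower_subset: "taylor_tower S F \<Longrightarrow> R \<subseteq> S \<Longrightarrow> taylor_tower R F"
  by (auto simp: taylor_tower_def)

text \<open>
  On an open set the bottom function of a tower determines all the others. The second claim
  goes beyond the first because \<^const>\<open>deriv\<close> also has a value where no derivative exists.
\<close>

lemma higher_deriv_eq_tower:
  assumes "open S" and F: "taylor_tower S F" and f: "\<And>t. t \<in> S \<Longrightarrow> f t = F 0 t"
    and "t \<in> S"
  shows "(deriv ^^ k) f t = fact k * F k t"
    and "((deriv ^^ k) f has_real_derivative fact (Suc k) * F (Suc k) t) (at t)"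
proof -
  have step: "((deriv ^^ k) f has_real_derivative fact (Suc k) * F (Suc k) t) (at t)"
    if eq: "\<And>u. u \<in> S \<Longrightarrow> (deriv ^^ k) f u = fact k * F k u" and "t \<in> S" for k t
  proof (rule has_field_derivative_transform_within_open[OF _ \<open>open S\<close> \<open>t \<in> S\<close>])
    show "((\<lambda>u. fact k * F k u) has_real_derivative fact (Suc k) * F (Suc k) t) (at t)"
      using DERIV_cmult[OF taylor_towerD[OF F \<open>t \<in> S\<close>, of k], of "fact k"]
      by (simp add: algebra_simps)
  qed (use eq in simp)
  have eq: "u \<in> S \<Longrightarrow> (deriv ^^ k) f u = fact k * F k u" for k u
  proof (induction k arbitrary: u)
    case 0
    then show ?case using f by simp
  next
    case (Suc k)
    show ?case
      using DERIV_imp_deriv[OF step[OF Suc.IH Suc.prems]] by simp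
  qed
  show "(deriv ^^ k) f t = fact k * F k t"
    by (rule eq[OF \<open>t \<in> S\<close>])
  show "((deriv ^^ k) f has_real_derivative fact (Suc k) * F (Suc k) t) (at t)"
    by (rule step[OF eq \<open>t \<in> S\<close>])
qed

lemma taylor_tower_unique:
  assumes "open S" "taylor_tower S F" "taylor_tower S G" "\<And>t. t \<in> S \<Longrightarrow> F 0 t = G 0 t" "t \<in> S"
  shows "F k t = G k t"
  using higher_deriv_eq_tower(1)[of S F "F 0" t k] higher_deriv_eq_tower(1)[of S G "F 0" t k] assms
  by simp

lemma smooth_imp_taylor_tower:
  assumes "smooth_on_reals S f"
  shows "taylor_tower S (\<lambda>k t. (deriv ^^ k) f t / fact k)"
  unfolding taylor_tower_def
proof (intro allI ballI)
  fix k t assume "t \<in> S"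
  then have "(deriv ^^ k) f differentiable at t"
    using assms by (simp add: smooth_on_reals_def)
  then have "((deriv ^^ k) f has_real_derivative (deriv ^^ Suc k) f t) (at t)"
    by (simp add: DERIV_deriv_iff_real_differentiable)
  then have "((\<lambda>t. (deriv ^^ k) f t / fact k) has_real_derivative (deriv ^^ Suc k) f t / fact k) (at t)"
    by (rule DERIV_cdivide)
  then show "((\<lambda>t. (deriv ^^ k) f t / fact k) has_real_derivative
      real (Suc k) * ((deriv ^^ Suc k) f t / fact (Suc k))) (at t)"
    by (simp add: field_simps del: funpow.simps of_nat_Suc)
qed

lemma taylor_tower_imp_smooth:
  assumes "open S" "taylor_tower S F" "\<And>t. t \<in> S \<Longrightarrow> f t = F 0 t"
  shows "smooth_on_reals S f"
  unfolding smooth_on_reals_def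
  using higher_deriv_eq_tower(2)[OF assms] real_differentiable_def by blast

lemma taylor_tower_sum:
  assumes "\<And>j. j \<in> J \<Longrightarrow> taylor_tower S (F j)"
  shows "taylor_tower S (\<lambda>k t. \<Sum>j\<in>J. F j k t)"
  unfolding taylor_tower_def sum_distrib_left
  by (intro allI ballI DERIV_sum taylor_towerD) (use assms in auto)

text \<open>
  Differentiating \<open>F\<^sub>p G\<^sub>k\<^sub>-\<^sub>p\<close> produces the products of total degree \<open>k + 1\<close>, where
  \<open>F\<^sub>p G\<^sub>k\<^sub>+\<^sub>1\<^sub>-\<^sub>p\<close> occurs with weight \<open>p\<close> from the left factor and \<open>k + 1 - p\<close> from the right
  one. The weights add up to \<open>k + 1\<close> in all cases.
\<close>

lemma taylor_tower_mult:
  assumes F: "taylor_tower S F" and G: "taylor_tower S G"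
  shows "taylor_tower S (\<lambda>k t. \<Sum>p\<le>k. F p t * G (k - p) t)"
  unfolding taylor_tower_def
proof (intro allI ballI)
  fix k t assume t: "t \<in> S"
  let ?H = "\<lambda>p. F p t * G (Suc k - p) t"
  have 1: "(\<Sum>p\<le>Suc k. real p * ?H p) = (\<Sum>p\<le>k. real (Suc p) * F (Suc p) t * G (k - p) t)"
    by (subst sum.atMost_Suc_shift) (simp add: mult_ac)
  have 2: "(\<Sum>p\<le>Suc k. real (Suc k - p) * ?H p) = (\<Sum>p\<le>k. real (Suc (k - p)) * G (Suc (k - p)) t * F p t)"
    by (subst sum.atMost_Suc) (simp add: Suc_diff_le mult_ac)
  have "real (Suc k) * (\<Sum>p\<le>Suc k. ?H p) = (\<Sum>p\<le>Suc k. real p * ?H p + real (Suc k - p) * ?H p)"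
    unfolding sum_distrib_left
    by (rule sum.cong[OF refl]) (simp add: of_nat_diff algebra_simps)
  also have "\<dots> = (\<Sum>p\<le>k. real (Suc p) * F (Suc p) t * G (k - p) t + real (Suc (k - p)) * G (Suc (k - p)) t * F p t)"
    unfolding sum.distrib 1 2 ..
  finally show "((\<lambda>t. \<Sum>p\<le>k. F p t * G (k - p) t) has_real_derivative
      real (Suc k) * (\<Sum>p\<le>Suc k. F p t * G (Suc k - p) t)) (at t)"
    by (simp only:) (intro DERIV_sum DERIV_mult taylor_towerD[OF F t] taylor_towerD[OF G t])
qed

lemma smooth_on_reals_zero: "smooth_on_reals S (\<lambda>t. 0)"
proof -
  have "(deriv ^^ k) (\<lambda>t. 0) = (\<lambda>t. 0 :: real)" for k
    by (induction k) auto
  then show ?thesis by (simp add: smooth_on_reals_def)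
qed

lemma smooth_on_reals_deriv: "smooth_on_reals S f \<Longrightarrow> smooth_on_reals S (deriv f)"
  unfolding smooth_on_reals_def by (metis funpow_Suc_right comp_apply)

lemma smooth_on_reals_sum:
  assumes "open S" "\<And>j. j \<in> J \<Longrightarrow> smooth_on_reals S (f j)"
  shows "smooth_on_reals S (\<lambda>t. \<Sum>j\<in>J. f j t)"
  by (rule taylor_tower_imp_smooth[OF assms(1) taylor_tower_sum[OF smooth_imp_taylor_tower]])
     (use assms in auto)

lemma smooth_on_reals_add:
  assumes "open S" "smooth_on_reals S f" "smooth_on_reals S g"
  shows "smooth_on_reals S (\<lambda>t. f t + g t)"
  using smooth_on_reals_sum[OF assms(1), of UNIV "\<lambda>b. if b then f else g"] assms
  by (simp add: UNIV_bool add.commute)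

lemma smooth_on_reals_mult:
  assumes "open S" "smooth_on_reals S f" "smooth_on_reals S g"
  shows "smooth_on_reals S (\<lambda>t. f t * g t)"
  by (rule taylor_tower_imp_smooth[OF assms(1) taylor_tower_mult[OF assms(2,3)[THEN smooth_imp_taylor_tower]]])
     auto

section \<open>Analytic functions\<close>

text \<open>
  Shifted power series: if \<open>f u = \<Sum>\<^sub>k a\<^sub>k (u - t)\<^sup>k\<close> near \<open>t\<close>, then
  \<open>F\<^sub>p u = \<Sum>\<^sub>k ((k + p) choose p) a\<^sub>k\<^sub>+\<^sub>p (u - t)\<^sup>k\<close>. The crude estimate of the binomial coefficient
  by \<open>2\<^sup>k\<^sup>+\<^sup>p\<close> costs a factor in the radius, which is harmless, and leaves a geometric bound in
  \<open>p\<close> that is uniform in \<open>u\<close>, and not only a bound at the centre.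
\<close>

lemma analytic_local_tower:
  assumes "real_analytic_on f S" "t \<in> S"
  obtains \<delta> A K F where "\<delta> > 0" "A > 0" "K > 0" "taylor_tower (ball t \<delta>) F"
    "\<And>u. u \<in> ball t \<delta> \<Longrightarrow> f u = F 0 u"
    "\<And>p u. u \<in> ball t \<delta> \<Longrightarrow> \<bar>F p u\<bar> \<le> A * K ^ p"
proof -
  obtain r a where "r > 0" and sums: "\<And>u. \<bar>u - t\<bar> < r \<Longrightarrow> (\<lambda>k. a k * (u - t) ^ k) sums f u"
    using assms unfolding real_analytic_on_def by blast
  \<comment> \<open>A radius strictly inside the disc of convergence, so that the terms are bounded on its boundary.\<close>
  define \<rho> where "\<rho> = r / 2"
  have \<rho>: "\<rho> > 0" using \<open>r > 0\<close> by (simp add: \<rho>_def)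
  have "summable (\<lambda>k. a k * \<rho> ^ k)"
    using sums[of "t + \<rho>"] \<open>r > 0\<close> by (auto simp: \<rho>_def intro: sums_summable)
  then have "Bseq (\<lambda>k. a k * \<rho> ^ k)"
    by (rule convergent_imp_Bseq[OF convergentI[OF summable_LIMSEQ_zero]])
  then obtain M where "M > 0" and M: "\<And>k. \<bar>a k * \<rho> ^ k\<bar> \<le> M"
    by (auto simp: Bseq_def)
  have a_bound: "\<bar>a k\<bar> \<le> M * (1 / \<rho>) ^ k" for k
    using M[of k] \<rho> by (simp add: abs_mult field_simps power_divide)
  define c where "c p k = real ((k + p) choose p) * a (k + p)" for p k
  have c_bound: "\<bar>c p k * w ^ k\<bar> \<le> M * (2 / \<rho>) ^ p * (2 * \<bar>w\<bar> / \<rho>) ^ k" for p k w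
  proof -
    have "real ((k + p) choose p) \<le> 2 ^ (k + p)"
      using binomial_le_pow2[of "k + p" p] by (metis of_nat_le_iff of_nat_numeral of_nat_power)
    then have "\<bar>c p k * w ^ k\<bar> \<le> (2 ^ (k + p) * (M * (1 / \<rho>) ^ (k + p))) * \<bar>w\<bar> ^ k"
      unfolding c_def abs_mult power_abs by (intro mult_right_mono mult_mono a_bound) auto
    also have "\<dots> = M * (2 / \<rho>) ^ p * (2 * \<bar>w\<bar> / \<rho>) ^ k"
      by (simp add: power_add power_divide power_mult_distrib mult_ac)
    finally show ?thesis .
  qed
  have geo: "summable (\<lambda>k. M * (2 / \<rho>) ^ p * (2 * \<bar>w\<bar> / \<rho>) ^ k)" if "\<bar>w\<bar> < \<rho> / 2" for p and w :: real
    using that \<rho> by (intro summable_mult summable_geometric) (simp add: field_simps)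
  have summ: "summable (\<lambda>k. c p k * w ^ k)" if "\<bar>w\<bar> < \<rho> / 2" for p w
    by (rule summable_comparison_test'[OF geo[OF that, of p], of 0]) (use c_bound in simp)
  define F where "F p u = (\<Sum>k. c p k * (u - t) ^ k)" for p u
  have diffs: "diffs (c p) k = real (Suc p) * c (Suc p) k" for p k
  proof -
    have "Suc p * (Suc (k + p) choose Suc p) = Suc k * (Suc (k + p) choose p)"
      using binomial_absorb_comp[of "Suc (k + p)" p] binomial_absorption[of p "Suc (k + p)"]
      by (simp add: Suc_diff_le del: binomial_Suc_Suc)
    then have "real (Suc p) * real (Suc (k + p) choose Suc p) = real (Suc k) * real (Suc (k + p) choose p)"
      by (metis of_nat_mult)
    then show ?thesis by (simp add: diffs_def c_def del: of_nat_Suc binomial_Suc_Suc)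
  qed
  show ?thesis
  proof (rule that[of "\<rho> / 4" "2 * M" "2 / \<rho>" F])
    show "taylor_tower (ball t (\<rho> / 4)) F"
      unfolding taylor_tower_def
    proof (intro allI ballI)
      fix p u assume u: "u \<in> ball t (\<rho> / 4)"
      have "((\<lambda>w. \<Sum>k. c p k * w ^ k) has_real_derivative (\<Sum>k. diffs (c p) k * (u - t) ^ k)) (at (u - t))"
        by (rule termdiffs_strong[of _ "\<rho> / 3"])
           (use \<rho> u in \<open>auto intro!: summ simp: dist_real_def abs_minus_commute\<close>)
      also have "(\<Sum>k. diffs (c p) k * (u - t) ^ k) = real (Suc p) * F (Suc p) u"
        unfolding diffs F_def mult.assoc
        by (rule suminf_mult) (use u \<rho> in \<open>auto intro!: summ simp: dist_real_def abs_minus_commute\<close>)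
      finally have "((\<lambda>w. \<Sum>k. c p k * w ^ k) has_real_derivative real (Suc p) * F (Suc p) u) (at (u + (- t)))"
        by simp
      from DERIV_shift[THEN iffD1, OF this] show "(F p has_real_derivative real (Suc p) * F (Suc p) u) (at u)"
        by (simp add: F_def[abs_def])
    qed
    fix u assume u: "u \<in> ball t (\<rho> / 4)"
    then have w: "\<bar>u - t\<bar> < \<rho> / 4"
      by (simp add: dist_real_def abs_minus_commute)
    show "f u = F 0 u"
      using sums[of u] w \<open>r > 0\<close> by (simp add: F_def c_def \<rho>_def sums_iff)
    fix p
    let ?q = "2 * \<bar>u - t\<bar> / \<rho>"
    have q: "0 \<le> ?q" "?q \<le> 1 / 2"
      using w \<rho> by (auto simp: field_simps)
    have small: "\<bar>u - t\<bar> < \<rho> / 2" using w \<rho> by simp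
    have "\<bar>F p u\<bar> \<le> (\<Sum>k. \<bar>c p k * (u - t) ^ k\<bar>)"
      unfolding F_def
      by (intro summable_rabs summable_comparison_test'[OF geo[OF small, of p], of 0])
         (use c_bound in simp)
    also have "\<dots> \<le> (\<Sum>k. M * (2 / \<rho>) ^ p * ?q ^ k)"
      by (intro suminf_le c_bound geo[OF small] summable_comparison_test'[OF geo[OF small, of p], of 0])
         (use c_bound in simp)
    also have "\<dots> = M * (2 / \<rho>) ^ p * (1 / (1 - ?q))"
      using q by (subst suminf_mult) (auto simp: suminf_geometric intro!: summable_geometric)
    also have "\<dots> \<le> M * (2 / \<rho>) ^ p * 2"
      using q \<open>M > 0\<close> \<rho> by (intro mult_left_mono) (auto simp: field_simps)
    finally show "\<bar>F p u\<bar> \<le> 2 * M * (2 / \<rho>) ^ p"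
      by (simp add: mult_ac)
  qed (use \<rho> \<open>M > 0\<close> in auto)
qed

lemma real_analytic_imp_smooth:
  assumes "real_analytic_on f S"
  shows "smooth_on_reals S f"
  unfolding smooth_on_reals_def
proof (intro allI ballI)
  fix k t assume "t \<in> S"
  obtain \<delta> A K F where "\<delta> > 0" "taylor_tower (ball t \<delta>) F" "\<And>u. u \<in> ball t \<delta> \<Longrightarrow> f u = F 0 u"
    using analytic_local_tower[OF assms \<open>t \<in> S\<close>] by metis
  then have "smooth_on_reals (ball t \<delta>) f"
    by (intro taylor_tower_imp_smooth[of _ F]) auto
  then show "(deriv ^^ k) f differentiable at t"
    using \<open>\<delta> > 0\<close> by (simp add: smooth_on_reals_def)
qed

section \<open>The coefficient functions\<close>

lemma smooth_driver_coeff: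
  assumes "open S" and v: "\<And>i j. smooth_on_reals S (v i j)"
  shows "smooth_on_reals S (driver_coeff v m s js)"
proof (induction m arbitrary: s js)
  case 0
  then show ?case by (simp add: smooth_on_reals_zero)
next
  case (Suc k)
  then show ?case
    by (auto intro!: v smooth_on_reals_zero smooth_on_reals_add smooth_on_reals_mult
        smooth_on_reals_sum smooth_on_reals_deriv \<open>open S\<close>)
qed

lemma driver_coeff_two: "driver_coeff v (Suc (Suc k)) 2 [i, j] = (deriv ^^ k) (v i j)"
  by (induction k) simp_all

text \<open>
  One formula for all three recursive cases, with \<open>r = s - 1\<close> the number of indices after the
  first. The missing summands at the two ends \<open>r = 1\<close> and \<open>r = k + 1\<close> are those that would
  refer to coefficients outside the triangle \<open>2 \<le> s \<le> m\<close>.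
\<close>

lemma driver_coeff_step:
  assumes "k \<ge> 1" "r \<ge> 1" "r \<le> Suc k"
  shows "driver_coeff v (Suc (Suc k)) (Suc r) js t =
    (if r \<ge> 2 then driver_coeff v (Suc k) r (butlast js) t * (\<Sum>j<r. v (js ! j) (js ! r) t) else 0) +
    (if r \<le> k then deriv (driver_coeff v (Suc k) (Suc r) js) t else 0)"
proof -
  consider "r = 1" | "r = Suc k" | "2 \<le> r" "r \<le> k" using assms by linarith
  then show ?thesis
  proof cases
    case 1
    then show ?thesis using \<open>k \<ge> 1\<close>
      unfolding driver_coeff.simps(2)[of v "Suc k"] by (simp add: numeral_2_eq_2 del: driver_coeff.simps)
  next
    case 2
    have "{0..k} = {..<Suc k}" by auto
    with 2 show ?thesis using \<open>k \<ge> 1\<close>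
      unfolding driver_coeff.simps(2)[of v "Suc k"] by (simp del: driver_coeff.simps sum.lessThan_Suc)
  next
    case 3
    then have "{0..Suc r - 2} = {..<r}" by auto
    with 3 show ?thesis using \<open>k \<ge> 1\<close>
      unfolding driver_coeff.simps(2)[of v "Suc k"] by (simp del: driver_coeff.simps)
  qed
qed

text \<open>
  The last index is split off because the recursion for the coefficients appends it.
\<close>

lemma sum_lists_Suc:
  fixes g :: "'n::finite list \<Rightarrow> real"
  shows "(\<Sum>js | length js = Suc r. g js) = (\<Sum>js | length js = r. \<Sum>l\<in>UNIV. g (js @ [l]))"
proof -
  have "(\<Sum>js | length js = r. \<Sum>l\<in>UNIV. g (js @ [l])) = (\<Sum>(js, l)\<in>{js. length js = r} \<times> UNIV. g (js @ [l]))"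
    by (rule sum.cartesian_product)
  also have "\<dots> = (\<Sum>js | length js = Suc r. g js)"
    by (rule sum.reindex_bij_witness[of _ "\<lambda>js. (butlast js, last js)" "\<lambda>(js, l). js @ [l]"])
       (auto simp: append_butlast_last_id simp flip: length_greater_0_conv)
  finally show ?thesis ..
qed

section \<open>Differentiation along the flow\<close>

text \<open>
  Each factor satisfies \<open>X\<^sub>j' = X\<^sub>j (\<Sum>\<^sub>l v\<^sub>j\<^sub>l X\<^sub>l)\<close>, so the derivative of a monomial is a
  combination of the monomials with one more index.
\<close>

lemma monomial_has_derivative:
  fixes X :: "real \<Rightarrow> real ^ 'n::finite"
  assumes X: "\<And>i. ((\<lambda>u. X u $ i) has_real_derivative (\<Sum>l\<in>UNIV. v i l t * X t $ i * X t $ l)) (at t)"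
  shows "((\<lambda>u. \<Prod>j\<leftarrow>js. X u $ j) has_real_derivative
      (\<Sum>l\<in>UNIV. (\<Sum>j<length js. v (js ! j) l t) * (\<Prod>j\<leftarrow>js @ [l]. X t $ j))) (at t)"
proof (induction js)
  case Nil
  then show ?case by simp
next
  case (Cons a js)
  show ?case
    using DERIV_mult[OF X[of a] Cons.IH]
    by (simp add: sum.lessThan_Suc_shift sum_distrib_left sum_distrib_right algebra_simps
        del: sum.lessThan_Suc flip: sum.distrib)
qed

text \<open>
  The claimed value of the \<open>k\<close>-th derivative, as a function of time. Lists are indexed by
  \<open>r = s - 1\<close>, so that the sum runs from \<open>1\<close> to \<open>k\<close>.
\<close>

definition driver_expansion ::
  "('n::finite \<Rightarrow> 'n \<Rightarrow> real \<Rightarrow> real) \<Rightarrow> (real \<Rightarrow> real ^ 'n) \<Rightarrow> nat \<Rightarrow> 'n \<Rightarrow> real \<Rightarrow> real" where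
  "driver_expansion v X k i t = (\<Sum>r=1..k. \<Sum>js | length js = r.
     driver_coeff v (Suc k) (Suc r) (i # js) t * (\<Prod>j\<leftarrow>i # js. X t $ j))"

text \<open>
  Product rule: derivatives of coefficients stay at the same list, derivatives of monomials move
  to the list with one more index. The recursion collects what arrives at a given list.
\<close>

lemma driver_expansion_has_derivative:
  fixes X :: "real \<Rightarrow> real ^ 'n::finite"
  assumes X: "\<And>i. ((\<lambda>u. X u $ i) has_real_derivative (\<Sum>l\<in>UNIV. v i l t * X t $ i * X t $ l)) (at t)"
    and smooth: "\<And>s js. driver_coeff v (Suc k) s js differentiable at t"
    and "k \<ge> 1"
  shows "(driver_expansion v X k i has_real_derivative driver_expansion v X (Suc k) i t) (at t)"
proof -
  define c where "c r js = driver_coeff v (Suc k) (Suc r) (i # js)" for r js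
  define c' where "c' r js = deriv (c r js) t" for r js
  define mon where "mon js u = (\<Prod>j\<leftarrow>i # js. X u $ j)" for js u
  define w where "w js l = (\<Sum>j<Suc (length js). v ((i # js) ! j) l t)" for js l
  have c: "(c r js has_real_derivative c' r js) (at t)" for r js
    unfolding c_def c'_def DERIV_deriv_iff_real_differentiable by (rule smooth)
  have mon: "(mon js has_real_derivative (\<Sum>l\<in>UNIV. w js l * mon (js @ [l]) t)) (at t)" for js
    using monomial_has_derivative[where X = X and v = v and t = t, OF X, of "i # js"] by (simp add: mon_def[abs_def] w_def)
  have "(driver_expansion v X k i has_real_derivative
      (\<Sum>r=1..k. \<Sum>js | length js = r. c' r js * mon js t + (\<Sum>l\<in>UNIV. w js l * mon (js @ [l]) t) * c r js t)) (at t)"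
    unfolding driver_expansion_def[abs_def] c_def[symmetric] mon_def[symmetric]
    by (intro DERIV_sum DERIV_mult c mon)
  moreover have "driver_expansion v X (Suc k) i t =
      (\<Sum>r=1..k. \<Sum>js | length js = r. c' r js * mon js t + (\<Sum>l\<in>UNIV. w js l * mon (js @ [l]) t) * c r js t)"
  proof -
    \<comment> \<open>The two contributions to a list: from its initial segment, and from the list itself.\<close>
    have split: "driver_coeff v (Suc (Suc k)) (Suc r) (i # js) t * mon js t =
        (if r \<ge> 2 then c (r - 1) (butlast js) t * w (butlast js) (last js) * mon js t else 0) +
        (if r \<le> k then c' r js * mon js t else 0)"
      if "r \<in> {1..Suc k}" "length js = r" for r js
    proof -
      have "js \<noteq> []" using that by auto
      then obtain ls l where js: "js = ls @ [l]" by (metis append_butlast_last_id)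
      have "(\<Sum>j<r. v ((i # js) ! j) ((i # js) ! r) t) = w ls l"
        unfolding w_def using that js by (intro sum.cong) (auto simp: nth_append nth_Cons')
      then show ?thesis
        using that js driver_coeff_step[of k r v "i # js" t] \<open>k \<ge> 1\<close>
        by (auto simp: c_def c'_def algebra_simps simp del: driver_coeff.simps)
    qed
    have "driver_expansion v X (Suc k) i t =
        (\<Sum>r=1..Suc k. (\<Sum>js | length js = r. if r \<ge> 2 then c (r - 1) (butlast js) t * w (butlast js) (last js) * mon js t else 0) +
        (\<Sum>js | length js = r. if r \<le> k then c' r js * mon js t else 0))"
      unfolding driver_expansion_def mon_def[symmetric] sum.distrib[symmetric]
      by (intro sum.cong refl split) auto
    also have "\<dots> = (\<Sum>r=1..Suc k. \<Sum>js | length js = r. if r \<ge> 2 then c (r - 1) (butlast js) t * w (butlast js) (last js) * mon js t else 0)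
        + (\<Sum>r=1..Suc k. \<Sum>js | length js = r. if r \<le> k then c' r js * mon js t else 0)"
      by (rule sum.distrib)
    also have "(\<Sum>r=1..Suc k. \<Sum>js | length js = r. if r \<ge> 2 then c (r - 1) (butlast js) t * w (butlast js) (last js) * mon js t else 0)
        = (\<Sum>r=Suc 1..Suc k. \<Sum>js | length js = r. c (r - 1) (butlast js) t * w (butlast js) (last js) * mon js t)"
      by (subst sum.atLeast_Suc_atMost) (auto intro!: sum.cong)
    also have "\<dots> = (\<Sum>r=1..k. \<Sum>js | length js = Suc r. c r (butlast js) t * w (butlast js) (last js) * mon js t)"
      by (subst sum.shift_bounds_cl_Suc_ivl) simp
    also have "\<dots> = (\<Sum>r=1..k. \<Sum>js | length js = r. (\<Sum>l\<in>UNIV. w js l * mon (js @ [l]) t) * c r js t)"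
      unfolding sum_lists_Suc butlast_snoc last_snoc sum_distrib_right by (simp only: mult_ac)
    also have "(\<Sum>r=1..Suc k. \<Sum>js | length js = r. if r \<le> k then c' r js * mon js t else 0)
        = (\<Sum>r=1..k. \<Sum>js | length js = r. c' r js * mon js t)"
      by (subst sum.cl_ivl_Suc) (auto intro!: sum.cong)
    finally show ?thesis
      by (simp add: sum.distrib add.commute)
  qed
  ultimately show ?thesis by simp
qed

lemma driver_expansion_one:
  "driver_expansion v X 1 i t = (\<Sum>l\<in>UNIV. v i l t * X t $ i * X t $ l)"
proof -
  have "(\<Sum>js | length js = Suc 0. driver_coeff v 2 2 (i # js) t * (\<Prod>j\<leftarrow>i # js. X t $ j))
      = (\<Sum>l\<in>UNIV. v i l t * X t $ i * X t $ l)"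
    by (subst sum_lists_Suc) (simp add: numeral_2_eq_2 mult_ac)
  then show ?thesis by (simp add: driver_expansion_def numeral_2_eq_2)
qed

text \<open>
  The identity must hold on all of the open set, and not only at one point, for the induction
  step to differentiate it.
\<close>

lemma higher_deriv_eq_driver_expansion:
  fixes X :: "real \<Rightarrow> real ^ 'n::finite"
  assumes "open I" and v: "\<And>i j. smooth_on_reals I (v i j)"
    and X: "\<And>t i. t \<in> I \<Longrightarrow> ((\<lambda>u. X u $ i) has_real_derivative (\<Sum>l\<in>UNIV. v i l t * X t $ i * X t $ l)) (at t)"
    and "k \<ge> 1" "t \<in> I"
  shows "(deriv ^^ k) (\<lambda>u. X u $ i) t = driver_expansion v X k i t"
    and "(deriv ^^ k) (\<lambda>u. X u $ i) differentiable at t"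
proof -
  have deriv_step: "((deriv ^^ k) (\<lambda>u. X u $ i) has_real_derivative driver_expansion v X (Suc k) i t) (at t)"
    if "k \<ge> 1" "t \<in> I" and eq: "\<And>u. u \<in> I \<Longrightarrow> (deriv ^^ k) (\<lambda>u. X u $ i) u = driver_expansion v X k i u" for k t
  proof (rule has_field_derivative_transform_within_open[OF _ \<open>open I\<close> \<open>t \<in> I\<close>])
    have "smooth_on_reals I (driver_coeff v (Suc k) s js)" for s js
      by (rule smooth_driver_coeff[OF \<open>open I\<close> v])
    then have "(deriv ^^ 0) (driver_coeff v (Suc k) s js) differentiable at t" for s js
      using \<open>t \<in> I\<close> unfolding smooth_on_reals_def by blast
    then show "(driver_expansion v X k i has_real_derivative driver_expansion v X (Suc k) i t) (at t)"
      using that by (intro driver_expansion_has_derivative X) auto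
  qed (use eq in simp)
  have eq: "t \<in> I \<Longrightarrow> (deriv ^^ k) (\<lambda>u. X u $ i) t = driver_expansion v X k i t" for t
    using \<open>k \<ge> 1\<close>
  proof (induction k arbitrary: t rule: dec_induct)
    case base
    then show ?case using DERIV_imp_deriv[OF X[of t i]] by (simp add: driver_expansion_one[unfolded One_nat_def])
  next
    case (step m)
    then show ?case using DERIV_imp_deriv[OF deriv_step[OF step.hyps(1) step.prems step.IH]] by simp
  qed
  show "(deriv ^^ k) (\<lambda>u. X u $ i) t = driver_expansion v X k i t"
    by (rule eq[OF \<open>t \<in> I\<close>])
  show "(deriv ^^ k) (\<lambda>u. X u $ i) differentiable at t"
    using deriv_step[OF \<open>k \<ge> 1\<close> \<open>t \<in> I\<close> eq] real_differentiable_def by blast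
qed

section \<open>Convergence of the Taylor series\<close>

text \<open>
  Induction on \<open>k\<close>. The inner Cauchy product has at most \<open>k + 1\<close> terms of size
  \<open>B\<^sup>2 C\<^sup>k\<^sup>-\<^sup>p\<close>. The condition \<open>C \<ge> 2 K\<close> turns the outer sum into \<open>A C\<^sup>k\<close> times a geometric series
  with ratio \<open>1 / 2\<close> and sum at most \<open>2\<close>. What remains is
  \<open>(k + 1) CARD('n) 2 A B\<^sup>2 C\<^sup>k\<close>, and the second condition on \<open>C\<close> bounds it by
  \<open>(k + 1) B C\<^sup>k\<^sup>+\<^sup>1\<close>.
\<close>

lemma quadratic_recurrence_bound:
  fixes a :: "'n::finite \<Rightarrow> nat \<Rightarrow> real" and V :: "'n \<Rightarrow> 'n \<Rightarrow> nat \<Rightarrow> real"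
  assumes rec: "\<And>i k. real (Suc k) * a i (Suc k) =
      (\<Sum>j\<in>UNIV. \<Sum>p\<le>k. V i j p * (\<Sum>q\<le>k - p. a i q * a j (k - p - q)))"
    and V: "\<And>i j p. \<bar>V i j p\<bar> \<le> A * K ^ p" and a0: "\<And>i. \<bar>a i 0\<bar> \<le> B"
    and pos: "A > 0" "K > 0" "B > 0"
    and C: "C \<ge> 2 * K" "C \<ge> 2 * real CARD('n) * A * B"
  shows "\<bar>a i k\<bar> \<le> B * C ^ k"
proof (induction k arbitrary: i rule: less_induct)
  case (less k)
  have "C > 0" using C(1) pos by linarith
  show ?case
  proof (cases k)
    case 0
    then show ?thesis using a0 by simp
  next
    case (Suc m)
    have inner: "\<bar>\<Sum>q\<le>m - p. a i q * a j (m - p - q)\<bar> \<le> real (Suc m) * B\<^sup>2 * C ^ (m - p)" for j p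
    proof -
      have "\<bar>\<Sum>q\<le>m - p. a i q * a j (m - p - q)\<bar> \<le> (\<Sum>q\<le>m - p. B\<^sup>2 * C ^ (m - p))"
      proof (rule order_trans[OF sum_abs sum_mono])
        fix q assume "q \<in> {..m - p}"
        then have "\<bar>a i q * a j (m - p - q)\<bar> \<le> (B * C ^ q) * (B * C ^ (m - p - q))"
          unfolding abs_mult using Suc pos \<open>C > 0\<close> by (intro mult_mono less.IH) auto
        also have "\<dots> = B\<^sup>2 * (C ^ q * C ^ (m - p - q))"
          by (simp add: power2_eq_square mult_ac)
        also have "C ^ q * C ^ (m - p - q) = C ^ (m - p)"
          using \<open>q \<in> {..m - p}\<close> by (metis le_add_diff_inverse power_add atMost_iff)
        finally show "\<bar>a i q * a j (m - p - q)\<bar> \<le> B\<^sup>2 * C ^ (m - p)" .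
      qed
      also have "\<dots> = real (Suc (m - p)) * (B\<^sup>2 * C ^ (m - p))" by simp
      also have "\<dots> \<le> real (Suc m) * (B\<^sup>2 * C ^ (m - p))"
        using \<open>C > 0\<close> by (intro mult_right_mono) auto
      finally show ?thesis by (simp only: mult.assoc)
    qed
    have outer: "\<bar>\<Sum>p\<le>m. V i j p * (\<Sum>q\<le>m - p. a i q * a j (m - p - q))\<bar> \<le> real (Suc m) * (2 * A * B\<^sup>2 * C ^ m)" for j
    proof -
      have "\<bar>\<Sum>p\<le>m. V i j p * (\<Sum>q\<le>m - p. a i q * a j (m - p - q))\<bar>
          \<le> (\<Sum>p\<le>m. (real (Suc m) * A * B\<^sup>2 * C ^ m) * (1 / 2) ^ p)"
      proof (rule order_trans[OF sum_abs sum_mono])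
        fix p assume p: "p \<in> {..m}"
        have "A * K ^ p \<le> A * (C / 2) ^ p"
          using C(1) pos by (intro mult_left_mono power_mono) auto
        then have "\<bar>V i j p\<bar> \<le> A * (C / 2) ^ p" using V order_trans by blast
        then have "\<bar>V i j p * (\<Sum>q\<le>m - p. a i q * a j (m - p - q))\<bar>
            \<le> (A * (C / 2) ^ p) * (real (Suc m) * B\<^sup>2 * C ^ (m - p))"
          unfolding abs_mult using pos \<open>C > 0\<close> by (intro mult_mono inner) auto
        also have "\<dots> = real (Suc m) * A * B\<^sup>2 * (C ^ p * C ^ (m - p)) * (1 / 2) ^ p"
          by (simp add: power_divide field_simps)
        also have "C ^ p * C ^ (m - p) = C ^ m" using p by (simp flip: power_add)
        finally show "\<bar>V i j p * (\<Sum>q\<le>m - p. a i q * a j (m - p - q))\<bar>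
            \<le> (real (Suc m) * A * B\<^sup>2 * C ^ m) * (1 / 2) ^ p" .
      qed
      also have "\<dots> = (real (Suc m) * A * B\<^sup>2 * C ^ m) * (\<Sum>p\<le>m. (1 / 2) ^ p)"
        by (simp only: sum_distrib_left)
      also have "(\<Sum>p\<le>m. (1 / 2 :: real) ^ p) \<le> 2"
        by (simp add: sum_gp0)
      finally show ?thesis using pos \<open>C > 0\<close> by (simp add: mult_ac)
    qed
    have "real (Suc m) * \<bar>a i (Suc m)\<bar> = \<bar>real (Suc m) * a i (Suc m)\<bar>"
      by (simp add: abs_mult)
    also have "\<dots> \<le> (\<Sum>j\<in>(UNIV :: 'n set). real (Suc m) * (2 * A * B\<^sup>2 * C ^ m))"
      unfolding rec by (rule order_trans[OF sum_abs sum_mono[OF outer]])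
    also have "\<dots> = real (Suc m) * ((2 * real CARD('n) * A * B) * (B * C ^ m))"
      by (simp add: power2_eq_square)
    also have "\<dots> \<le> real (Suc m) * (C * (B * C ^ m))"
      using C(2) pos \<open>C > 0\<close> by (intro mult_left_mono mult_right_mono) auto
    finally have "\<bar>a i (Suc m)\<bar> \<le> C * (B * C ^ m)"
      by (subst (asm) mult_le_cancel_left_pos) auto
    then show ?thesis by (simp add: Suc mult_ac)
  qed
qed

text \<open>
  The Lagrange remainder of order \<open>n\<close> is \<open>F\<^sub>n \<xi> (t - t0)\<^sup>n\<close> for some intermediate point \<open>\<xi>\<close>. Since
  \<open>\<xi>\<close> varies with \<open>n\<close>, the bound has to be uniform on the ball.
\<close>

lemma taylor_tower_sums:
  assumes F: "taylor_tower (ball t0 \<delta>) F"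
    and bound: "\<And>k t. t \<in> ball t0 \<delta> \<Longrightarrow> \<bar>F k t\<bar> \<le> B * C ^ k"
    and t: "\<bar>t - t0\<bar> < \<delta>" "C * \<bar>t - t0\<bar> < 1" and "C > 0"
  shows "(\<lambda>k. F k t0 * (t - t0) ^ k) sums F 0 t"
proof -
  define q where "q = C * \<bar>t - t0\<bar>"
  have q: "0 \<le> q" "q < 1" using t \<open>C > 0\<close> by (auto simp: q_def)
  have rem: "\<bar>F 0 t - (\<Sum>k<n. F k t0 * (t - t0) ^ k)\<bar> \<le> B * q ^ n" for n
  proof -
    define diff where "diff m h = fact m * F m (t0 + h)" for m h
    have "(diff m has_real_derivative diff (Suc m) h) (at h)" if "\<bar>h\<bar> \<le> \<bar>t - t0\<bar>" for m h
    proof -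
      have "(F m has_real_derivative real (Suc m) * F (Suc m) (t0 + h)) (at (h + t0))"
        using taylor_towerD[OF F, of "t0 + h" m] that t by (simp add: dist_real_def add.commute)
      then have "((\<lambda>h. F m (h + t0)) has_real_derivative real (Suc m) * F (Suc m) (t0 + h)) (at h)"
        by (simp only: DERIV_shift)
      from DERIV_cmult[OF this, of "fact m"] show ?thesis
        by (simp add: diff_def[abs_def] algebra_simps)
    qed
    then obtain h where h: "\<bar>h\<bar> \<le> \<bar>t - t0\<bar>"
      and eq: "diff 0 (t - t0) = (\<Sum>m<n. diff m 0 / fact m * (t - t0) ^ m) + diff n h / fact n * (t - t0) ^ n"
      using Maclaurin_bi_le[of diff "diff 0" n "t - t0"] by blast
    have "\<bar>F 0 t - (\<Sum>k<n. F k t0 * (t - t0) ^ k)\<bar> = \<bar>F n (t0 + h)\<bar> * \<bar>t - t0\<bar> ^ n"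
      using eq by (simp add: diff_def abs_mult power_abs)
    also have "\<dots> \<le> (B * C ^ n) * \<bar>t - t0\<bar> ^ n"
      using h t by (intro mult_right_mono bound) (auto simp: dist_real_def)
    finally show ?thesis by (simp add: q_def power_mult_distrib mult_ac)
  qed
  have "(\<lambda>n. B * q ^ n) \<longlonglongrightarrow> 0"
    using q by (intro tendsto_mult_right_zero LIMSEQ_realpow_zero)
  then have "(\<lambda>n. F 0 t - (\<Sum>k<n. F k t0 * (t - t0) ^ k)) \<longlonglongrightarrow> 0"
    by (rule Lim_null_comparison[rotated]) (use rem in simp)
  then show ?thesis
    unfolding sums_def using Lim_transform2[of "\<lambda>n. F 0 t" "F 0 t"] by (simp add: tendsto_const)
qed

text \<open>
  Since the index type is finite, the smallest radius and the largest constants serve all members.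
\<close>

lemma finite_family_analytic_bound:
  fixes f :: "'b::finite \<Rightarrow> real \<Rightarrow> real"
  assumes "\<And>b. real_analytic_on (f b) S" "t \<in> S"
  obtains \<delta> A K F where "\<delta> > 0" "A > 0" "K > 0" "\<And>b. taylor_tower (ball t \<delta>) (F b)"
    "\<And>b u. u \<in> ball t \<delta> \<Longrightarrow> f b u = F b 0 u"
    "\<And>b p u. u \<in> ball t \<delta> \<Longrightarrow> \<bar>F b p u\<bar> \<le> A * K ^ p"
proof -
  have "\<exists>\<delta> A K F. \<delta> > 0 \<and> A > 0 \<and> K > 0 \<and> taylor_tower (ball t \<delta>) F \<and>
      (\<forall>u\<in>ball t \<delta>. f b u = F 0 u) \<and> (\<forall>p. \<forall>u\<in>ball t \<delta>. \<bar>F p u\<bar> \<le> A * K ^ p)" for b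
    using analytic_local_tower[OF assms(1)[of b] assms(2)] by (smt (verit))
  then obtain \<delta> A K F where *: "\<And>b. \<delta> b > 0" "\<And>b. A b > 0" "\<And>b. K b > 0"
      "\<And>b. taylor_tower (ball t (\<delta> b)) (F b)"
      "\<And>b u. u \<in> ball t (\<delta> b) \<Longrightarrow> f b u = F b 0 u"
      "\<And>b p u. u \<in> ball t (\<delta> b) \<Longrightarrow> \<bar>F b p u\<bar> \<le> A b * K b ^ p"
    by metis
  define d where "d = Min (range \<delta>)"
  have "ball t d \<subseteq> ball t (\<delta> b)" for b
    by (rule subset_ball) (simp add: d_def)
  moreover have "A b * K b ^ p \<le> Max (range A) * Max (range K) ^ p" for b p
    using *(2,3)[of b] by (intro mult_mono power_mono) (auto intro: less_imp_le order_trans[of _ "A b"] Max_ge)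
  moreover have "d > 0" "Max (range A) > 0" "Max (range K) > 0"
    using *(1-3) by (auto simp: d_def Max_gr_iff)
  ultimately show ?thesis
    using that[of d "Max (range A)" "Max (range K)" F] *(4-6) taylor_tower_subset
    by (meson in_mono order_trans)
qed

text \<open>
  Both sides of the differential equation are bottoms of towers, the left one being the shifted
  tower of \<open>X\<^sub>i\<close> and the right one a sum of Cauchy products. Uniqueness of towers turns the
  equation into the recurrence for the normalised derivatives at every point of the ball.
\<close>

lemma driver_solution_local_bound:
  fixes X :: "real \<Rightarrow> real ^ 'n::finite"
  assumes "open I" "t0 \<in> I" and v: "\<And>i j. real_analytic_on (v i j) I"
    and X: "\<And>t i. t \<in> I \<Longrightarrow> ((\<lambda>u. X u $ i) has_real_derivative (\<Sum>l\<in>UNIV. v i l t * X t $ i * X t $ l)) (at t)"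
    and smooth: "\<And>i. smooth_on_reals I (\<lambda>u. X u $ i)"
  obtains \<delta> B C where "\<delta> > 0" "C > 0" "ball t0 \<delta> \<subseteq> I"
    "\<And>i k t. t \<in> ball t0 \<delta> \<Longrightarrow> \<bar>(deriv ^^ k) (\<lambda>u. X u $ i) t / fact k\<bar> \<le> B * C ^ k"
proof -
  \<comment> \<open>A compact ball, on which the solution is bounded by continuity.\<close>
  obtain \<epsilon> where "\<epsilon> > 0" and \<epsilon>: "cball t0 \<epsilon> \<subseteq> I"
    using \<open>open I\<close> \<open>t0 \<in> I\<close> open_contains_cball by blast
  obtain \<delta>' A K V where V: "\<delta>' > 0" "A > 0" "K > 0" "\<And>b. taylor_tower (ball t0 \<delta>') (V b)"
    "\<And>b u. u \<in> ball t0 \<delta>' \<Longrightarrow> v (fst b) (snd b) u = V b 0 u"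
    "\<And>b p u. u \<in> ball t0 \<delta>' \<Longrightarrow> \<bar>V b p u\<bar> \<le> A * K ^ p"
    using finite_family_analytic_bound[of "\<lambda>b. v (fst b) (snd b)" I t0] v \<open>t0 \<in> I\<close> by metis
  define \<delta> where "\<delta> = min \<epsilon> \<delta>'"
  have sub: "ball t0 \<delta> \<subseteq> cball t0 \<epsilon>" "ball t0 \<delta> \<subseteq> I" "ball t0 \<delta> \<subseteq> ball t0 \<delta>'"
    using \<epsilon> by (auto simp: \<delta>_def)
  have cont: "continuous_on (cball t0 \<epsilon>) X"
  proof -
    have "continuous_on (cball t0 \<epsilon>) (\<lambda>t. X t $ i)" for i
      using X \<epsilon> by (intro continuous_at_imp_continuous_on ballI) (blast intro: DERIV_isCont)
    then show ?thesis by (rule continuous_on_vec_lambda[of _ "\<lambda>i t. X t $ i", simplified])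
  qed
  then have "bounded (X ` cball t0 \<epsilon>)"
    by (intro compact_imp_bounded compact_continuous_image) auto
  then obtain B where "B > 0" and B: "\<And>t. t \<in> cball t0 \<epsilon> \<Longrightarrow> norm (X t) \<le> B"
    unfolding bounded_pos by auto
  define a where "a i k t = (deriv ^^ k) (\<lambda>u. X u $ i) t / fact k" for i k t
  have a: "taylor_tower (ball t0 \<delta>) (a i)" for i
    unfolding a_def[abs_def] by (rule taylor_tower_subset[OF smooth_imp_taylor_tower[OF smooth] sub(2)])
  have rec: "real (Suc k) * a i (Suc k) t =
      (\<Sum>j\<in>UNIV. \<Sum>p\<le>k. V (i, j) p t * (\<Sum>q\<le>k - p. a i q t * a j (k - p - q) t))"
    if t: "t \<in> ball t0 \<delta>" for i k t
  proof (rule taylor_tower_unique[OF open_ball _ _ _ t])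
    show "taylor_tower (ball t0 \<delta>) (\<lambda>k t. real (Suc k) * a i (Suc k) t)"
      unfolding taylor_tower_def by (intro allI ballI DERIV_cmult taylor_towerD[OF a])
    show "taylor_tower (ball t0 \<delta>)
        (\<lambda>k t. \<Sum>j\<in>UNIV. \<Sum>p\<le>k. V (i, j) p t * (\<Sum>q\<le>k - p. a i q t * a j (k - p - q) t))"
      by (intro taylor_tower_sum taylor_tower_mult taylor_tower_subset[OF V(4) sub(3)] a)
    fix u assume u: "u \<in> ball t0 \<delta>"
    then show "real (Suc 0) * a i (Suc 0) u =
        (\<Sum>j\<in>UNIV. \<Sum>p\<le>0. V (i, j) p u * (\<Sum>q\<le>0 - p. a i q u * a j (0 - p - q) u))"
      using DERIV_imp_deriv[OF X[of u i]] V(5)[of u "(i, _)"] subsetD[OF sub(2) u] subsetD[OF sub(3) u]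
      by (simp add: a_def mult_ac)
  qed
  define C where "C = max (2 * K) (2 * real CARD('n) * A * B)"
  have "\<bar>a i k t\<bar> \<le> B * C ^ k" if t: "t \<in> ball t0 \<delta>" for i k t
  proof (rule quadratic_recurrence_bound[where V = "\<lambda>i j p. V (i, j) p t" and a = "\<lambda>i k. a i k t"
        and A = A and K = K])
    fix i show "\<bar>a i 0 t\<bar> \<le> B"
      using B[of t] component_le_norm_cart[of "X t" i] t sub by (auto simp: a_def)
  qed (use rec[OF t] V(2,3) V(6) t sub \<open>B > 0\<close> in \<open>auto simp: C_def\<close>)
  moreover have "C > 0" "\<delta> > 0" using V \<open>\<epsilon> > 0\<close> by (auto simp: C_def \<delta>_def)
  ultimately show ?thesis
    using that[of \<delta> C B] sub by (simp add: a_def)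
qed

theorem theorem3p1:
  fixes v :: "'n::finite \<Rightarrow> 'n \<Rightarrow> real \<Rightarrow> real"
    and T I :: "real set" and t0 :: real
    and x :: "real ^ 'n" and X :: "real \<Rightarrow> real ^ 'n"
  assumes "open_interval T"
    and "\<And>i j. real_analytic_on (v i j) T"
    and "x \<in> nonzero_coords" and "t0 \<in> T"
    and "maximal_driver_solution v T t0 x I X"
  shows "(\<exists>r>0. {t0 - r<..<t0 + r} \<subseteq> I \<and>
            (\<forall>i. \<forall>t\<in>{t0 - r<..<t0 + r}.
               (\<lambda>k. taylor_coeff X t0 k i * ((t - t0) ^ k / fact k)) sums (X t $ i)))
       \<and> (\<forall>i. taylor_coeff X t0 0 i = x $ i)
       \<and> (\<forall>k\<ge>1. \<forall>i. taylor_coeff X t0 k i =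
            (\<Sum>s=2..k+1. \<Sum>js\<in>{js :: 'n list. length js = s - 1}.
               driver_coeff v (k + 1) s (i # js) t0 * (x $ i * (\<Prod>j\<leftarrow>js. x $ j))))
       \<and> (\<forall>k\<ge>2. \<forall>i i1. \<forall>t\<in>I. driver_coeff v (k + 1) 2 [i, i1] t = (deriv ^^ (k - 1)) (v i i1) t)"
proof -
  have I: "open I" "I \<subseteq> T" "t0 \<in> I" "X t0 = x"
    and X: "\<And>t i. t \<in> I \<Longrightarrow> ((\<lambda>u. X u $ i) has_real_derivative (\<Sum>j\<in>UNIV. v i j t * X t $ i * X t $ j)) (at t)"
    using assms(5) by (auto simp: maximal_driver_solution_def driver_solution_def open_interval_def)
  have v: "real_analytic_on (v i j) I" for i j
    using assms(2)[of i j] \<open>I \<subseteq> T\<close> by (auto simp: real_analytic_on_def)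
  have expansion: "(deriv ^^ k) (\<lambda>u. X u $ i) t = driver_expansion v X k i t"
      "(deriv ^^ k) (\<lambda>u. X u $ i) differentiable at t" if "k \<ge> 1" "t \<in> I" for k i t
    by (rule higher_deriv_eq_driver_expansion[where I = I, OF \<open>open I\<close> real_analytic_imp_smooth[OF v] X];
        use that in simp)+
  have smooth: "smooth_on_reals I (\<lambda>u. X u $ i)" for i
    unfolding smooth_on_reals_def
  proof (intro allI ballI)
    fix k t assume "t \<in> I"
    then show "(deriv ^^ k) (\<lambda>u. X u $ i) differentiable at t"
      using expansion(2)[of k t i] X[of t i] real_differentiable_def by (cases "k = 0") auto
  qed
  have "\<exists>r>0. {t0 - r<..<t0 + r} \<subseteq> I \<and> (\<forall>i. \<forall>t\<in>{t0 - r<..<t0 + r}.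
      (\<lambda>k. taylor_coeff X t0 k i * ((t - t0) ^ k / fact k)) sums (X t $ i))"
  proof (rule driver_solution_local_bound[where X = X and v = v, OF \<open>open I\<close> \<open>t0 \<in> I\<close> v X smooth])
    fix \<delta> B C :: real
    assume *: "\<delta> > 0" "C > 0" "ball t0 \<delta> \<subseteq> I"
      "\<And>i k t. t \<in> ball t0 \<delta> \<Longrightarrow> \<bar>(deriv ^^ k) (\<lambda>u. X u $ i) t / fact k\<bar> \<le> B * C ^ k"
    \<comment> \<open>Inside this radius the terms \<open>B (C \<bar>t - t0\<bar>)\<^sup>k\<close> that bound the remainder tend to zero.\<close>
    define r where "r = min \<delta> (1 / C)"
    have "{t0 - r<..<t0 + r} \<subseteq> ball t0 \<delta>"
      by (auto simp: r_def dist_real_def)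
    moreover have "(\<lambda>k. taylor_coeff X t0 k i * ((t - t0) ^ k / fact k)) sums (X t $ i)"
      if "t \<in> {t0 - r<..<t0 + r}" for i t
    proof -
      have "\<bar>t - t0\<bar> < \<delta>" "\<bar>t - t0\<bar> < 1 / C" using that by (auto simp: r_def)
      then have "(\<lambda>k. (deriv ^^ k) (\<lambda>u. X u $ i) t0 / fact k * (t - t0) ^ k) sums
          ((deriv ^^ 0) (\<lambda>u. X u $ i) t / fact 0)"
        using \<open>C > 0\<close>
        by (intro taylor_tower_sums[where F = "\<lambda>k t. (deriv ^^ k) (\<lambda>u. X u $ i) t / fact k",
              OF taylor_tower_subset[OF smooth_imp_taylor_tower[OF smooth] *(3)] *(4)])
           (auto simp: field_simps)
      then show ?thesis by (simp add: taylor_coeff_def)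
    qed
    moreover have "r > 0" using * by (simp add: r_def)
    ultimately show "\<exists>r>0. {t0 - r<..<t0 + r} \<subseteq> I \<and> (\<forall>i. \<forall>t\<in>{t0 - r<..<t0 + r}.
        (\<lambda>k. taylor_coeff X t0 k i * ((t - t0) ^ k / fact k)) sums (X t $ i))"
      using *(3) by (intro exI[of _ r]) auto
  qed
  moreover have "taylor_coeff X t0 0 i = x $ i" for i
    by (simp add: taylor_coeff_def I)
  moreover have "taylor_coeff X t0 k i = (\<Sum>s=2..k+1. \<Sum>js\<in>{js :: 'n list. length js = s - 1}.
      driver_coeff v (k + 1) s (i # js) t0 * (x $ i * (\<Prod>j\<leftarrow>js. x $ j)))" if "k \<ge> 1" for k i
  proof -
    have shift: "(\<Sum>s=2..k+1. f s) = (\<Sum>r=1..k. f (Suc r))" for f :: "nat \<Rightarrow> real"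
      using sum.shift_bounds_cl_Suc_ivl[of f 1 k] by (simp add: numeral_2_eq_2 del: sum.cl_ivl_Suc)
    show ?thesis
      using expansion(1)[OF that \<open>t0 \<in> I\<close>, of i] unfolding shift
      by (simp add: taylor_coeff_def driver_expansion_def I del: driver_coeff.simps)
  qed
  moreover have "driver_coeff v (k + 1) 2 [i, i1] t = (deriv ^^ (k - 1)) (v i i1) t" if "k \<ge> 2" for k i i1 t
    using driver_coeff_two[of v "k - 1" i i1] that by (simp del: driver_coeff.simps)
  ultimately show ?thesis by blast
qed

end
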